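(* Let $\mathcal{A}$ be a unital Banach algebra and let $a\in\mathcal{A}$ be Moore-Penrose invertible with Moore-Penrose inverse $a^{\dagger}$. When $a$ is co-EP, let $h,k\in\mathcal{A}$ denote the unique idempotents such that $h\mathcal{A}=a\mathcal{A}$, $(1-h)\mathcal{A}=a^{\dagger}\mathcal{A}$, $\mathcal{A}k=\mathcal{A}a^{\dagger}$ and $\mathcal{A}(1-k)=\mathcal{A}a$. Then the following statements are equivalent. (i) $a$ is co-EP and $h$ is hermitian; (ii) $a$ is co-EP and $h=aa^{\dagger}$; (iii) $a^{\dagger}a+aa^{\dagger}=1$; (iv) $a\mathcal{A}=a^{-1}(0)$; (v) $\mathcal{A}a=a_{-1}(0)$; (vi) $a$ is co-EP and $k=aa^{\dagger}$; (vii) $a$ is co-EP and $k$ is hermitian; (viii) $a$ is co-EP and $k=h$; (ix) $a$ is co-EP and $a^2=0$; (x) $a^{\dagger}\mathcal{A}=(a^{\dagger})^{-1}(0)$; (xi) $\mathcal{A}a^{\dagger}=(a^{\dagger})_{-1}(0)$; (xii) $a$ is co-EP and bi-EP.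
   Context: $\mathcal{A}$ denotes a complex unital Banach algebra with unit $1$. An element $c\in\mathcal{A}$ is hermitian if $\|\exp(itc)\|=1$ for all $t\in\mathbb{R}$. An element $a\in\mathcal{A}$ is Moore-Penrose invertible if there exists $x\in\mathcal{A}$ with $axa=a$, $xax=x$ and both $ax$ and $xa$ hermitian; such $x$ is unique, is called the Moore-Penrose inverse of $a$ and is denoted $a^{\dagger}$. A Moore-Penrose invertible element $a$ is co-EP if $aa^{\dagger}-a^{\dagger}a$ is invertible in $\mathcal{A}$, and bi-EP if the idempotents $aa^{\dagger}$ and $a^{\dagger}a$ commute. It is known that if $a$ is co-EP then there exist idempotents $h,k\in\mathcal{A}$ with $h\mathcal{A}=a\mathcal{A}$, $(1-h)\mathcal{A}=a^{\dagger}\mathcal{A}$, $\mathcal{A}k=\mathcal{A}a^{\dagger}$, $\mathcal{A}(1-k)=\mathcal{A}a$, and they are unique. For $c\in\mathcal{A}$: $c\mathcal{A}=\{cx: x\in\mathcal{A}\}$, $\mathcal{A}c=\{xc: x\in\mathcal{A}\}$, $c^{-1}(0)=\{x\in\mathcal{A}: cx=0\}$, $c_{-1}(0)=\{x\in\mathcal{A}: xc=0\}$. *)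

theory Defs
  imports Complex_Main
begin

(* The distribution has no complex algebras, so a complex scalar multiplication
   extending the real one is added to real_normed_algebra_1 + banach.  The
   inherited law norm 1 = 1 is no restriction here: every algebra containing a
   hermitian element c satisfies norm 1 = norm (exp (i 0 c)) = 1. *)
class complex_banach_algebra_1 = real_normed_algebra_1 + banach +
  fixes scaleC :: "complex \<Rightarrow> 'a \<Rightarrow> 'a"  (infixr "*\<^sub>C" 75)
  assumes scaleC_add_right: "\<alpha> *\<^sub>C (x + y) = \<alpha> *\<^sub>C x + \<alpha> *\<^sub>C y"
    and scaleC_add_left: "(\<alpha> + \<beta>) *\<^sub>C x = \<alpha> *\<^sub>C x + \<beta> *\<^sub>C x"
    and scaleC_scaleC: "\<alpha> *\<^sub>C \<beta> *\<^sub>C x = (\<alpha> * \<beta>) *\<^sub>C x"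
    and scaleR_scaleC: "r *\<^sub>R x = complex_of_real r *\<^sub>C x"
    and mult_scaleC_left: "(\<alpha> *\<^sub>C x) * y = \<alpha> *\<^sub>C (x * y)"
    and mult_scaleC_right: "x * (\<alpha> *\<^sub>C y) = \<alpha> *\<^sub>C (x * y)"
    and norm_scaleC: "norm (\<alpha> *\<^sub>C x) = cmod \<alpha> * norm x"

instantiation complex :: complex_banach_algebra_1
begin

definition scaleC_complex :: "complex \<Rightarrow> complex \<Rightarrow> complex"
  where "scaleC_complex \<alpha> x = \<alpha> * x"

instance
  by standard (simp_all add: scaleC_complex_def algebra_simps norm_mult scaleR_conv_of_real)

end

definition hermitian :: "'a::complex_banach_algebra_1 \<Rightarrow> bool"
  where "hermitian c \<longleftrightarrow> (\<forall>t::real. norm (exp ((\<i> * complex_of_real t) *\<^sub>C c)) = 1)"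

definition idempotent :: "'a::semigroup_mult \<Rightarrow> bool"
  where "idempotent e \<longleftrightarrow> e * e = e"

definition invertible_elem :: "'a::monoid_mult \<Rightarrow> bool"
  where "invertible_elem x \<longleftrightarrow> (\<exists>y. x * y = 1 \<and> y * x = 1)"

definition right_ideal :: "'a::semigroup_mult \<Rightarrow> 'a set"
  where "right_ideal c = {c * x | x. True}"

definition left_ideal :: "'a::semigroup_mult \<Rightarrow> 'a set"
  where "left_ideal c = {x * c | x. True}"

(* right_annihilator c is c^(-1)(0), and left_annihilator c is c_(-1)(0) *)
definition right_annihilator :: "'a::ring \<Rightarrow> 'a set"
  where "right_annihilator c = {x. c * x = 0}"

definition left_annihilator :: "'a::ring \<Rightarrow> 'a set"
  where "left_annihilator c = {x. x * c = 0}"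

definition is_mp_inverse :: "'a::complex_banach_algebra_1 \<Rightarrow> 'a \<Rightarrow> bool"
  where "is_mp_inverse a x \<longleftrightarrow>
    a * x * a = a \<and> x * a * x = x \<and> hermitian (a * x) \<and> hermitian (x * a)"

definition mp_invertible :: "'a::complex_banach_algebra_1 \<Rightarrow> bool"
  where "mp_invertible a \<longleftrightarrow> (\<exists>x. is_mp_inverse a x)"

definition mp_inverse :: "'a::complex_banach_algebra_1 \<Rightarrow> 'a"  ("(_\<^sup>\<dagger>)" [1000] 999)
  where "a\<^sup>\<dagger> = (THE x. is_mp_inverse a x)"

definition co_EP :: "'a::complex_banach_algebra_1 \<Rightarrow> bool"
  where "co_EP a \<longleftrightarrow> mp_invertible a \<and> invertible_elem (a * a\<^sup>\<dagger> - a\<^sup>\<dagger> * a)"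

definition bi_EP :: "'a::complex_banach_algebra_1 \<Rightarrow> bool"
  where "bi_EP a \<longleftrightarrow> mp_invertible a \<and> (a * a\<^sup>\<dagger>) * (a\<^sup>\<dagger> * a) = (a\<^sup>\<dagger> * a) * (a * a\<^sup>\<dagger>)"

(* co_EP_h a and co_EP_k a are the idempotents h and k attached to a co-EP
   element a; they are only meaningful under co_EP a. *)
definition is_co_EP_h :: "'a::complex_banach_algebra_1 \<Rightarrow> 'a \<Rightarrow> bool"
  where "is_co_EP_h a h \<longleftrightarrow> idempotent h \<and>
    right_ideal h = right_ideal a \<and> right_ideal (1 - h) = right_ideal (a\<^sup>\<dagger>)"

definition is_co_EP_k :: "'a::complex_banach_algebra_1 \<Rightarrow> 'a \<Rightarrow> bool"
  where "is_co_EP_k a k \<longleftrightarrow> idempotent k \<and>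
    left_ideal k = left_ideal (a\<^sup>\<dagger>) \<and> left_ideal (1 - k) = left_ideal a"

definition co_EP_h :: "'a::complex_banach_algebra_1 \<Rightarrow> 'a"
  where "co_EP_h a = (THE h. is_co_EP_h a h)"

definition co_EP_k :: "'a::complex_banach_algebra_1 \<Rightarrow> 'a"
  where "co_EP_k a = (THE k. is_co_EP_k a k)"

definition all_equivalent :: "bool list \<Rightarrow> bool"
  where "all_equivalent Ps \<longleftrightarrow> (\<forall>P\<in>set Ps. \<forall>Q\<in>set Ps. P \<longleftrightarrow> Q)"

(* The remaining facts show that the three definite descriptions above are
   well defined. *)

lemma exp_scaleC_idempotent:
  fixes p :: "'a::complex_banach_algebra_1"
  assumes p: "idempotent p"
  shows "exp (z *\<^sub>C p) = 1 + (exp z - 1) *\<^sub>C p"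
proof -
  have bl: "bounded_linear (\<lambda>w. w *\<^sub>C p)"
    by (rule bounded_linear_intro[where K = "norm p"])
      (simp_all add: scaleC_add_left scaleR_scaleC[where 'a = 'a] scaleR_conv_of_real[where 'a = complex] scaleC_scaleC norm_scaleC)
  have one: "1 *\<^sub>C x = x" for x :: 'a
    using scaleR_scaleC[of 1 x] by simp
  have pow: "(z *\<^sub>C p) ^ Suc n = z ^ Suc n *\<^sub>C p" for n
  proof (induction n)
    case (Suc n)
    have "(z *\<^sub>C p) ^ Suc (Suc n) = (z *\<^sub>C p) * (z ^ Suc n *\<^sub>C p)"
      using Suc by simp
    also have "\<dots> = z ^ Suc (Suc n) *\<^sub>C p"
      using p by (simp add: mult_scaleC_left mult_scaleC_right scaleC_scaleC idempotent_def mult_ac)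
    finally show ?case .
  qed simp
  have "(\<lambda>n. z ^ n /\<^sub>R fact n) sums exp z"
    by (rule exp_converges)
  then have "(\<lambda>n. (z ^ n /\<^sub>R fact n) *\<^sub>C p) sums (exp z *\<^sub>C p)"
    by (rule bounded_linear.sums[OF bl])
  then have "(\<lambda>n. (z ^ Suc n /\<^sub>R fact (Suc n)) *\<^sub>C p) sums (exp z *\<^sub>C p - 1 *\<^sub>C p)"
    using sums_Suc_iff[of "\<lambda>n. (z ^ n /\<^sub>R fact n) *\<^sub>C p" "exp z *\<^sub>C p - 1 *\<^sub>C p"] by simp
  moreover have "(z ^ Suc n /\<^sub>R fact (Suc n)) *\<^sub>C p = (z *\<^sub>C p) ^ Suc n /\<^sub>R fact (Suc n)" for n
    unfolding pow by (simp only: scaleR_scaleC[where 'a = 'a] scaleC_scaleC scaleR_conv_of_real)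
  ultimately have "(\<lambda>n. (z *\<^sub>C p) ^ Suc n /\<^sub>R fact (Suc n)) sums (exp z *\<^sub>C p - 1 *\<^sub>C p)"
    by (simp only:)
  then have "(\<lambda>n. (z *\<^sub>C p) ^ n /\<^sub>R fact n) sums (exp z *\<^sub>C p - 1 *\<^sub>C p + 1)"
    by (subst (asm) sums_Suc_iff) simp
  with exp_converges[of "z *\<^sub>C p"] have "exp (z *\<^sub>C p) = exp z *\<^sub>C p - 1 *\<^sub>C p + 1"
    by (rule sums_unique2)
  then show ?thesis
    using scaleC_add_left[of "exp z - 1" 1 p] by (simp add: algebra_simps)
qed

lemma norm_hermitian_idempotent:
  fixes p :: "'a::complex_banach_algebra_1"
  assumes "idempotent p" "hermitian p"
  shows "norm (1 - 2 * p) = 1"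
proof -
  have one: "1 *\<^sub>C x = x" for x :: 'a
    using scaleR_scaleC[of 1 x] by simp
  have "(-2) *\<^sub>C p = (-2) *\<^sub>R p"
    by (simp add: scaleR_scaleC)
  also have "\<dots> = - (2 * p)"
    by (simp add: scaleR_conv_of_real)
  finally have "exp ((\<i> * complex_of_real pi) *\<^sub>C p) = 1 - 2 * p"
    unfolding exp_scaleC_idempotent[OF assms(1)] by (simp add: exp_pi_i')
  then show ?thesis
    using assms(2) unfolding hermitian_def by metis
qed

lemma power_bounded_nilpotent_eq_0:
  fixes n :: "'a::complex_banach_algebra_1"
  assumes "n * n = 0" "norm (1 + 2 * n) \<le> 1"
  shows "n = 0"
proof (rule ccontr)
  assume "n \<noteq> 0"
  then obtain k where k: "real k * norm n > 2"
    using reals_Archimedean3[of "norm n"] by auto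
  have pow: "(1 + 2 * n) ^ k = 1 + of_nat k * (2 * n)" for k
  proof (induction k)
    case (Suc k)
    have "2 * n * (of_nat k * (2 * n)) = of_nat k * 4 * (n * n)"
      by (metis (no_types, lifting) mult.assoc mult_of_nat_commute of_nat_numeral
          mult_2 distrib_left distrib_right assms(1) mult_zero_right mult_zero_left add_0)
    with Suc assms(1) show ?case
      by (simp add: algebra_simps)
  qed simp
  have "norm ((1 + 2 * n) ^ k) \<le> norm (1 + 2 * n) ^ k"
    by (rule norm_power_ineq)
  also have "\<dots> \<le> 1"
    using assms(2) by (simp add: power_le_one)
  finally have "norm (1 + of_nat k * (2 * n)) \<le> 1"
    by (simp only: pow)
  moreover have "of_nat k * (2 * n) = (2 * real k) *\<^sub>R n"
    by (simp add: scaleR_conv_of_real mult.assoc[symmetric] mult_of_nat_commute)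
  ultimately have "norm ((2 * real k) *\<^sub>R n) \<le> 2"
    using norm_triangle_ineq4[of "1 + (2 * real k) *\<^sub>R n" 1] by simp
  with k show False
    by simp
qed

lemma hermitian_idempotent_eqI:
  fixes p q :: "'a::complex_banach_algebra_1"
  assumes "idempotent p" "idempotent q" "hermitian p" "hermitian q"
    and "p * q = q \<and> q * p = p \<or> p * q = p \<and> q * p = q"
  shows "p = q"
proof -
  have "norm ((1 - 2 * p) * (1 - 2 * q)) \<le> norm (1 - 2 * p) * norm (1 - 2 * q)"
    by (rule norm_mult_ineq)
  then have le: "norm ((1 - 2 * p) * (1 - 2 * q)) \<le> 1"
    using assms by (simp add: norm_hermitian_idempotent)
  have eq: "(1 - 2 * p) * (1 - 2 * q) = 1 - 2 * p - 2 * q + (2 * (p * q) + 2 * (p * q))"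
  proof -
    have "(2 * p) * (2 * q) = 2 * (p * q) + 2 * (p * q)"
      by (simp only: mult_2 distrib_left distrib_right add.assoc)
    then show ?thesis
      by (simp add: algebra_simps)
  qed
  from assms(5) show ?thesis
  proof
    assume A: "p * q = q \<and> q * p = p"
    have "(q - p) * (q - p) = 0"
      using A assms(1,2) by (simp add: algebra_simps idempotent_def)
    moreover have "norm (1 + 2 * (q - p)) \<le> 1"
      using le A unfolding eq by (simp add: right_diff_distrib algebra_simps)
    ultimately show ?thesis
      using power_bounded_nilpotent_eq_0 by fastforce
  next
    assume A: "p * q = p \<and> q * p = q"
    have "(p - q) * (p - q) = 0"
      using A assms(1,2) by (simp add: algebra_simps idempotent_def)
    moreover have "norm (1 + 2 * (p - q)) \<le> 1"
      using le A unfolding eq by (simp add: right_diff_distrib algebra_simps)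
    ultimately show ?thesis
      using power_bounded_nilpotent_eq_0 by fastforce
  qed
qed

lemma mp_inverse_unique:
  assumes x: "is_mp_inverse a x" and y: "is_mp_inverse a y"
  shows "x = y"
proof -
  have X: "a * x * a = a" "x * a * x = x" "hermitian (a * x)" "hermitian (x * a)"
    and Y: "a * y * a = a" "y * a * y = y" "hermitian (a * y)" "hermitian (y * a)"
    using x y by (simp_all add: is_mp_inverse_def)
  have "a * x = a * y"
  proof (rule hermitian_idempotent_eqI)
    show "a * x * (a * y) = a * y \<and> a * y * (a * x) = a * x \<or>
        a * x * (a * y) = a * x \<and> a * y * (a * x) = a * y"
      by (metis X(1) Y(1) mult.assoc)
  qed (use X Y in \<open>simp_all add: idempotent_def flip: mult.assoc\<close>)
  moreover have "x * a = y * a"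
  proof (rule hermitian_idempotent_eqI)
    show "x * a * (y * a) = y * a \<and> y * a * (x * a) = x * a \<or>
        x * a * (y * a) = x * a \<and> y * a * (x * a) = y * a"
      by (metis X(1) Y(1) mult.assoc)
  qed (use X Y in \<open>simp_all add: idempotent_def flip: mult.assoc\<close>)
  ultimately show ?thesis
    using X(2) Y(2) by (metis mult.assoc)
qed

lemma is_mp_inverse_mp_inverse:
  assumes "mp_invertible a"
  shows "is_mp_inverse a (a\<^sup>\<dagger>)"
  unfolding mp_inverse_def
  using assms mp_inverse_unique by (auto simp: mp_invertible_def intro: theI)

lemma right_ideal_subset_iff:
  fixes c :: "'a::monoid_mult"
  shows "right_ideal c \<subseteq> right_ideal d \<longleftrightarrow> (\<exists>x. c = d * x)"
proof
  assume "right_ideal c \<subseteq> right_ideal d"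
  moreover have "c \<in> right_ideal c"
    unfolding right_ideal_def by (auto intro: exI[of _ 1])
  ultimately show "\<exists>x. c = d * x"
    by (auto simp: right_ideal_def)
qed (auto simp: right_ideal_def mult.assoc)

lemma left_ideal_subset_iff:
  fixes c :: "'a::monoid_mult"
  shows "left_ideal c \<subseteq> left_ideal d \<longleftrightarrow> (\<exists>x. c = x * d)"
proof
  assume "left_ideal c \<subseteq> left_ideal d"
  moreover have "c \<in> left_ideal c"
    unfolding left_ideal_def by (auto intro: exI[of _ 1])
  ultimately show "\<exists>x. c = x * d"
    by (auto simp: left_ideal_def)
next
  assume "\<exists>x. c = x * d"
  then show "left_ideal c \<subseteq> left_ideal d"
    by (auto simp: left_ideal_def) (metis mult.assoc)
qed

lemma ex1_is_co_EP_h: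
  assumes "co_EP a"
  shows "\<exists>!h. is_co_EP_h a h"
proof (rule ex_ex1I)
  define P Q where "P = a * a\<^sup>\<dagger>" and "Q = a\<^sup>\<dagger> * a"
  from assms obtain v where v: "(P - Q) * v = 1" "v * (P - Q) = 1"
    by (auto simp: co_EP_def invertible_elem_def P_def Q_def)
  have mp: "a * a\<^sup>\<dagger> * a = a" "a\<^sup>\<dagger> * a * a\<^sup>\<dagger> = a\<^sup>\<dagger>"
    using assms is_mp_inverse_mp_inverse[of a] by (simp_all add: co_EP_def is_mp_inverse_def)
  have PP: "P * P = P" and QQ: "Q * Q = Q"
    using mp by (simp_all add: P_def Q_def flip: mult.assoc)
  have hv: "P * v = v * (1 - Q)"
  proof -
    have "(P - Q) * P = (1 - Q) * (P - Q)"
      by (simp add: algebra_simps PP QQ)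
    then have "v * ((P - Q) * P) * v = v * ((1 - Q) * (P - Q)) * v"
      by simp
    then show ?thesis
      using v by (metis mult.assoc mult_1_left mult_1_right)
  qed
  have hP: "P * v * P = P"
  proof -
    have "(1 - Q) * P = (P - Q) * P"
      by (simp add: algebra_simps PP)
    then show ?thesis
      unfolding hv using v by (metis mult.assoc mult_1_left)
  qed
  have h1: "1 - P * v = - (Q * v)"
    using v by (simp add: algebra_simps)
  have h2: "(1 - P * v) * Q = Q"
    unfolding hv by (simp add: algebra_simps QQ)
  show "\<exists>h. is_co_EP_h a h"
  proof (intro exI[of _ "P * v"], unfold is_co_EP_h_def, intro conjI equalityI)
    show "idempotent (P * v)"
      using hP by (simp add: idempotent_def flip: mult.assoc)
    show "right_ideal (P * v) \<subseteq> right_ideal a"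
      unfolding right_ideal_subset_iff P_def by (metis mult.assoc)
    have "a = P * v * a"
      using hP mp(1) unfolding P_def by (metis mult.assoc)
    then show "right_ideal a \<subseteq> right_ideal (P * v)"
      unfolding right_ideal_subset_iff by blast
    have "1 - P * v = a\<^sup>\<dagger> * (a * (- v))"
      unfolding h1 Q_def by (simp add: mult.assoc)
    then show "right_ideal (1 - P * v) \<subseteq> right_ideal (a\<^sup>\<dagger>)"
      unfolding right_ideal_subset_iff by blast
    have "a\<^sup>\<dagger> = (1 - P * v) * a\<^sup>\<dagger>"
      using h2 mp(2) unfolding Q_def by (metis mult.assoc)
    then show "right_ideal (a\<^sup>\<dagger>) \<subseteq> right_ideal (1 - P * v)"
      unfolding right_ideal_subset_iff by blast
  qed
next
  fix h h' assume "is_co_EP_h a h" "is_co_EP_h a h'"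
  then have i: "h * h = h" "h' * h' = h'"
    and "right_ideal h = right_ideal h'" "right_ideal (1 - h) = right_ideal (1 - h')"
    by (simp_all add: is_co_EP_h_def idempotent_def)
  then obtain x y where x: "h = h' * x" and y: "1 - h = (1 - h') * y"
    by (metis right_ideal_subset_iff subset_refl)
  have "h' * h = h"
    using x i(2) by (metis mult.assoc)
  moreover have "h' * (1 - h) = 0"
    using y i(2) by (simp add: right_diff_distrib flip: mult.assoc)
  ultimately show "h = h'"
    by (simp add: algebra_simps)
qed

lemma ex1_is_co_EP_k:
  assumes "co_EP a"
  shows "\<exists>!k. is_co_EP_k a k"
proof (rule ex_ex1I)
  define P Q where "P = a * a\<^sup>\<dagger>" and "Q = a\<^sup>\<dagger> * a"
  from assms obtain v where v: "(P - Q) * v = 1" "v * (P - Q) = 1"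
    by (auto simp: co_EP_def invertible_elem_def P_def Q_def)
  have mp: "a * a\<^sup>\<dagger> * a = a" "a\<^sup>\<dagger> * a * a\<^sup>\<dagger> = a\<^sup>\<dagger>"
    using assms is_mp_inverse_mp_inverse[of a] by (simp_all add: co_EP_def is_mp_inverse_def)
  have PP: "P * P = P" and QQ: "Q * Q = Q"
    using mp by (simp_all add: P_def Q_def flip: mult.assoc)
  have hv: "v * P = (1 - Q) * v"
  proof -
    have "P * (P - Q) = (P - Q) * (1 - Q)"
      by (simp add: algebra_simps PP QQ)
    then have "v * (P * (P - Q)) * v = v * ((P - Q) * (1 - Q)) * v"
      by simp
    then show ?thesis
      using v by (metis mult.assoc mult_1_left mult_1_right)
  qed
  have hP: "P * (v * P) = P"
  proof -
    have "P * (1 - Q) = P * (P - Q)"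
      by (simp add: algebra_simps PP)
    then show ?thesis
      unfolding hv using v by (metis mult.assoc mult_1_right)
  qed
  have h1: "1 - v * P = - (v * Q)"
    using v by (simp add: algebra_simps)
  have h2: "Q * (1 - v * P) = Q"
  proof -
    have "Q * (1 - Q) = 0"
      by (simp add: algebra_simps QQ)
    then have "Q * (v * P) = 0"
      unfolding hv by (metis mult.assoc mult_zero_left)
    then show ?thesis
      by (simp add: algebra_simps)
  qed
  show "\<exists>k. is_co_EP_k a k"
  proof (intro exI[of _ "v * P"], unfold is_co_EP_k_def, intro conjI equalityI)
    show "idempotent (v * P)"
      using hP by (simp add: idempotent_def mult.assoc)
    show "left_ideal (v * P) \<subseteq> left_ideal (a\<^sup>\<dagger>)"
      unfolding left_ideal_subset_iff P_def by (metis mult.assoc)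
    have "a\<^sup>\<dagger> = a\<^sup>\<dagger> * (v * P)"
      using hP mp(2) unfolding P_def by (metis mult.assoc)
    then show "left_ideal (a\<^sup>\<dagger>) \<subseteq> left_ideal (v * P)"
      unfolding left_ideal_subset_iff by blast
    have "1 - v * P = (- v * a\<^sup>\<dagger>) * a"
      unfolding h1 Q_def by (simp add: mult.assoc)
    then show "left_ideal (1 - v * P) \<subseteq> left_ideal a"
      unfolding left_ideal_subset_iff by blast
    have "a = a * (1 - v * P)"
      using h2 mp(1) unfolding Q_def by (metis mult.assoc)
    then show "left_ideal a \<subseteq> left_ideal (1 - v * P)"
      unfolding left_ideal_subset_iff by blast
  qed
next
  fix k k' assume "is_co_EP_k a k" "is_co_EP_k a k'"
  then have i: "k * k = k" "k' * k' = k'"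
    and "left_ideal k = left_ideal k'" "left_ideal (1 - k) = left_ideal (1 - k')"
    by (simp_all add: is_co_EP_k_def idempotent_def)
  then obtain x y where x: "k = x * k'" and y: "1 - k = y * (1 - k')"
    by (metis left_ideal_subset_iff subset_refl)
  have "k * k' = k"
    using x i(2) by (metis mult.assoc)
  moreover have "(1 - k) * k' = 0"
    using y i(2) by (simp add: mult.assoc left_diff_distrib)
  ultimately show "k = k'"
    by (simp add: algebra_simps)
qed

end

(* Put P = a a^+ and Q = a^+ a, both hermitian idempotents.  The principal ideals
   and annihilators of a and a^+ are those of P, Q, 1 - P and 1 - Q, and a hermitian
   idempotent is determined by either principal ideal it generates; so each of the
   conditions on ideals, on h and on k forces P = 1 - Q.  In the two remaining
   conditions D = P - Q is invertible: if P and Q commute, then D (1 - P - Q) = 0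
   gives the claim, and if a^2 = 0, then Q P = 0 and D^3 = D, so D^2 = 1, which says
   (1 - P) (1 - Q) = 0; hence P and 1 - Q generate the same right ideal. *)

theory Submission imports Defs begin

lemma idempotent_one_minus:
  fixes p :: "'a::ring_1"
  assumes "idempotent p"
  shows "idempotent (1 - p)"
  using assms by (simp add: idempotent_def algebra_simps)

text \<open>The closed form of the exponential on idempotents gives exp (z (1 - p)) = e^z exp (-z
  p). For z = i t the scalar e^z has modulus 1, so the norm for 1 - p at t is the norm for p at
  -t.\<close>

lemma hermitian_one_minus_idempotent:
  fixes p :: "'a::complex_banach_algebra_1"
  assumes p: "idempotent p" and "hermitian p"
  shows "hermitian (1 - p)"
  unfolding hermitian_def
proof
  fix t :: real
  define z where "z = \<i> * complex_of_real t"
  have one: "1 *\<^sub>C x = x" for x :: 'a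
    using scaleR_scaleC[of 1 x] by simp
  have minus: "(- w) *\<^sub>C x = - (w *\<^sub>C x)" for w and x :: 'a
    using scaleC_add_left[of w "- w" x] scaleR_scaleC[of 0 x]
    by (simp add: minus_unique)
  have diffr: "w *\<^sub>C (1 - p) = w *\<^sub>C 1 - w *\<^sub>C p" for w
    using scaleC_add_right[of w "1 - p" p] by simp
  have "exp (z *\<^sub>C (1 - p)) = 1 + (exp z - 1) *\<^sub>C (1 - p)"
    by (rule exp_scaleC_idempotent[OF idempotent_one_minus[OF p]])
  also have "\<dots> = exp z *\<^sub>C 1 + (1 - exp z) *\<^sub>C p"
    using scaleC_add_left[of "exp z - 1" 1 "1 :: 'a"] minus[of "exp z - 1" p]
    by (simp add: diffr one)
  also have "\<dots> = exp z *\<^sub>C exp ((- z) *\<^sub>C p)"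
    by (simp add: exp_scaleC_idempotent[OF p] scaleC_add_right scaleC_scaleC
        algebra_simps flip: exp_add)
  finally have "norm (exp (z *\<^sub>C (1 - p))) = norm (exp ((\<i> * complex_of_real (- t)) *\<^sub>C p))"
    by (simp add: norm_scaleC z_def)
  with \<open>hermitian p\<close> show "norm (exp ((\<i> * complex_of_real t) *\<^sub>C (1 - p))) = 1"
    unfolding hermitian_def z_def by metis
qed

text \<open>If c = p x, then p c = p p x = c. This turns inclusions of ideals into equations between
  products.\<close>

lemma right_ideal_subset_idempotent_iff:
  fixes p :: "'a::monoid_mult"
  assumes "idempotent p"
  shows "right_ideal c \<subseteq> right_ideal p \<longleftrightarrow> p * c = c"
  using assms unfolding right_ideal_subset_iff idempotent_def by (metis mult.assoc)

lemma left_ideal_subset_idempotent_iff: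
  fixes p :: "'a::monoid_mult"
  assumes "idempotent p"
  shows "left_ideal c \<subseteq> left_ideal p \<longleftrightarrow> c * p = c"
  using assms unfolding left_ideal_subset_iff idempotent_def by (metis mult.assoc)

lemma right_annihilator_idempotent:
  fixes p :: "'a::ring_1"
  assumes "idempotent p"
  shows "right_annihilator p = right_ideal (1 - p)"
proof -
  have "p * ((1 - p) * x) = 0" for x
    using assms by (simp add: idempotent_def algebra_simps flip: mult.assoc)
  moreover have "x = (1 - p) * x" if "p * x = 0" for x
    using that by (simp add: algebra_simps)
  ultimately show ?thesis
    unfolding right_annihilator_def right_ideal_def by fastforce
qed

lemma left_annihilator_idempotent:
  fixes p :: "'a::ring_1"
  assumes "idempotent p"
  shows "left_annihilator p = left_ideal (1 - p)"
proof -
  have "x * (1 - p) * p = 0" for x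
    using assms by (simp add: idempotent_def algebra_simps)
  moreover have "x = x * (1 - p)" if "x * p = 0" for x
    using that by (simp add: algebra_simps)
  ultimately show ?thesis
    unfolding left_annihilator_def left_ideal_def by fastforce
qed

text \<open>The two inclusions say p q = q and q p = p, the first alternative in
  \<open>hermitian_idempotent_eqI\<close>; for left ideals they give the second one.\<close>

lemma hermitian_idempotent_right_ideal_eq_iff:
  fixes p q :: "'a::complex_banach_algebra_1"
  assumes "idempotent p" "idempotent q" "hermitian p" "hermitian q"
  shows "right_ideal p = right_ideal q \<longleftrightarrow> p = q"
  using right_ideal_subset_idempotent_iff[OF assms(1), of q]
    right_ideal_subset_idempotent_iff[OF assms(2), of p]
    hermitian_idempotent_eqI[OF assms] by auto

lemma hermitian_idempotent_left_ideal_eq_iff: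
  fixes p q :: "'a::complex_banach_algebra_1"
  assumes "idempotent p" "idempotent q" "hermitian p" "hermitian q"
  shows "left_ideal p = left_ideal q \<longleftrightarrow> p = q"
  using left_ideal_subset_idempotent_iff[OF assms(1), of q]
    left_ideal_subset_idempotent_iff[OF assms(2), of p]
    hermitian_idempotent_eqI[OF assms] by auto

context
  fixes a b :: "'a::monoid_mult"
  assumes aba: "a * b * a = a"
begin

text \<open>Serves to pass from elements to idempotents. The hypothesis holds for the pair
  \<open>a\<close>, \<open>a\<^sup>\<dagger>\<close> in either order, so these facts cover the
  ideals of both elements.\<close>

lemma right_ideal_mult_inner_inverse: "right_ideal (a * b) = right_ideal a"
  by (rule equalityI; unfold right_ideal_subset_iff; metis aba)

lemma left_ideal_mult_inner_inverse: "left_ideal (b * a) = left_ideal a"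
  by (rule equalityI; unfold left_ideal_subset_iff; metis aba mult.assoc)

end

context
  fixes a b :: "'a::ring_1"
  assumes aba: "a * b * a = a"
begin

text \<open>If b a x = 0, then a x = a (b a x) = 0.\<close>

lemma right_annihilator_mult_inner_inverse: "right_annihilator (b * a) = right_annihilator a"
  unfolding right_annihilator_def by (metis aba mult.assoc mult_zero_right)

lemma left_annihilator_mult_inner_inverse: "left_annihilator (a * b) = left_annihilator a"
  unfolding left_annihilator_def by (metis aba mult.assoc mult_zero_left)

end

lemma invertible_elem_mult_eq_0D:
  fixes d :: "'a::ring_1"
  assumes "invertible_elem d" "d * x = 0"
  shows "x = 0"
  using assms unfolding invertible_elem_def by (metis mult.assoc mult_1_left mult_zero_right)

text \<open>For any idempotents, (p - q) (1 - p - q) = q p - p q; here the commutator vanishes and p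
  - q can be cancelled.\<close>

lemma commuting_idempotents_sum_eq_1:
  fixes p q :: "'a::ring_1"
  assumes "idempotent p" "idempotent q" "p * q = q * p" "invertible_elem (p - q)"
  shows "q + p = 1"
proof -
  have "(p - q) * (1 - p - q) = 0"
    using assms(1-3) by (simp add: idempotent_def algebra_simps)
  then have "1 - p - q = 0"
    by (rule invertible_elem_mult_eq_0D[OF assms(4)])
  then show ?thesis
    by (simp add: algebra_simps)
qed

text \<open>With q p = 0 the square of d = p - q is p + q - p q, and multiplying by d once more
  gives back d. Cancelling d leaves p + q - p q = 1, a rearrangement of the claim.\<close>

lemma idempotents_mult_eq_0_complement:
  fixes p q :: "'a::ring_1"
  assumes "idempotent p" "idempotent q" "q * p = 0" "invertible_elem (p - q)"
  shows "p * (1 - q) = 1 - q"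
proof -
  have [simp]: "p * p = p" "q * q = q" "q * p = 0"
    using assms by (simp_all add: idempotent_def)
  \<comment> \<open>\<open>algebra_simps\<close> nests products to the right, so each relation is
    also supplied with a trailing factor.\<close>
  have [simp]: "p * (p * x) = p * x" "q * (q * x) = q * x" "q * (p * x) = 0" for x
    by (simp_all flip: mult.assoc)
  have "(p - q) * ((p - q) * (p - q) - 1) = 0"
    by (simp add: algebra_simps)
  then have "(p - q) * (p - q) - 1 = 0"
    by (rule invertible_elem_mult_eq_0D[OF assms(4)])
  then show ?thesis
    by (simp add: algebra_simps)
qed

theorem theorem3p3:
  fixes a :: "'a::complex_banach_algebra_1"
  assumes "mp_invertible a"
  shows "all_equivalent
    [co_EP a \<and> hermitian (co_EP_h a),
     co_EP a \<and> co_EP_h a = a * a\<^sup>\<dagger>,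
     a\<^sup>\<dagger> * a + a * a\<^sup>\<dagger> = 1,
     right_ideal a = right_annihilator a,
     left_ideal a = left_annihilator a,
     co_EP a \<and> co_EP_k a = a * a\<^sup>\<dagger>,
     co_EP a \<and> hermitian (co_EP_k a),
     co_EP a \<and> co_EP_k a = co_EP_h a,
     co_EP a \<and> a\<^sup>2 = 0,
     right_ideal (a\<^sup>\<dagger>) = right_annihilator (a\<^sup>\<dagger>),
     left_ideal (a\<^sup>\<dagger>) = left_annihilator (a\<^sup>\<dagger>),
     co_EP a \<and> bi_EP a]"
proof -
  define P Q where "P = a * a\<^sup>\<dagger>" and "Q = a\<^sup>\<dagger> * a"
  let ?iii = "Q + P = 1"
  have mp: "a * a\<^sup>\<dagger> * a = a" "a\<^sup>\<dagger> * a * a\<^sup>\<dagger> = a\<^sup>\<dagger>" and hP: "hermitian P" and hQ: "hermitian Q"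
    using is_mp_inverse_mp_inverse[OF assms] by (simp_all add: is_mp_inverse_def P_def Q_def)
  have iP: "idempotent P" and iQ: "idempotent Q"
    using mp by (simp_all add: idempotent_def P_def Q_def flip: mult.assoc)
  note PQ = iP iQ hP hQ iP[THEN idempotent_one_minus] iQ[THEN idempotent_one_minus]
    hermitian_one_minus_idempotent[OF iP hP] hermitian_one_minus_idempotent[OF iQ hQ]
  note ideals =
    right_ideal_mult_inner_inverse[OF mp(1), folded P_def]
    right_ideal_mult_inner_inverse[OF mp(2), folded Q_def]
    left_ideal_mult_inner_inverse[OF mp(1), folded Q_def]
    left_ideal_mult_inner_inverse[OF mp(2), folded P_def]
    right_annihilator_mult_inner_inverse[OF mp(1), folded Q_def]
    right_annihilator_mult_inner_inverse[OF mp(2), folded P_def]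
    left_annihilator_mult_inner_inverse[OF mp(1), folded P_def]
    left_annihilator_mult_inner_inverse[OF mp(2), folded Q_def]
  note annihilators = right_annihilator_idempotent left_annihilator_idempotent
  note ideal_eq = hermitian_idempotent_right_ideal_eq_iff hermitian_idempotent_left_ideal_eq_iff
  have coEP_iff: "co_EP a \<longleftrightarrow> invertible_elem (P - Q)"
    using assms by (simp add: co_EP_def P_def Q_def)

  \<comment> \<open>In terms of generators, (iv) compares the right ideals of P and 1 - Q, (v) the
    left ideals of Q and 1 - P, (x) the right ideals of Q and 1 - P, and (xi) the left ideals of P
    and 1 - Q.\<close>
  have iv: "right_ideal a = right_annihilator a \<longleftrightarrow> ?iii"
    and v: "left_ideal a = left_annihilator a \<longleftrightarrow> ?iii"
    and x: "right_ideal (a\<^sup>\<dagger>) = right_annihilator (a\<^sup>\<dagger>) \<longleftrightarrow> ?iii"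
    and xi: "left_ideal (a\<^sup>\<dagger>) = left_annihilator (a\<^sup>\<dagger>) \<longleftrightarrow> ?iii"
    unfolding ideals[symmetric] using PQ
    by (auto simp: annihilators ideal_eq algebra_simps)

  have h: "is_co_EP_h a (co_EP_h a)" and k: "is_co_EP_k a (co_EP_k a)" if "co_EP a"
    unfolding co_EP_h_def co_EP_k_def
    using theI'[OF ex1_is_co_EP_h[OF that]] theI'[OF ex1_is_co_EP_k[OF that]] by simp_all
  have hD: "idempotent (co_EP_h a)" "right_ideal (co_EP_h a) = right_ideal P"
      "right_ideal (1 - co_EP_h a) = right_ideal Q"
    and kD: "idempotent (co_EP_k a)" "left_ideal (co_EP_k a) = left_ideal P"
      "left_ideal (1 - co_EP_k a) = left_ideal Q" if "co_EP a"
    using h[OF that] k[OF that] by (simp_all add: is_co_EP_h_def is_co_EP_k_def ideals)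

  \<comment> \<open>(iii) is the hub: here it yields all that the conditions involving co-EP demand;
    the converses follow one by one.\<close>
  have coEP: "co_EP a" and h_eq: "co_EP_h a = P" and k_eq: "co_EP_k a = P"
    and sq: "a\<^sup>2 = 0" and biEP: "bi_EP a" if iii: ?iii
  proof -
    have Q: "Q = 1 - P"
      using iii by (simp add: algebra_simps)
    \<comment> \<open>P - Q = 2 P - 1 is a reflection, hence its own inverse.\<close>
    have "(P - Q) * (P - Q) = 1"
      using iP unfolding Q by (simp add: idempotent_def algebra_simps)
    then show co: "co_EP a"
      unfolding coEP_iff invertible_elem_def by blast
    have "is_co_EP_h a P" "is_co_EP_k a P"
      using iP by (simp_all add: is_co_EP_h_def is_co_EP_k_def ideals flip: Q)
    then show "co_EP_h a = P" "co_EP_k a = P"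
      using h[OF co] k[OF co] ex1_is_co_EP_h[OF co] ex1_is_co_EP_k[OF co] by blast+
    have QP: "Q * P = 0" "P * Q = 0"
      using iP unfolding Q by (simp_all add: idempotent_def algebra_simps)
    \<comment> \<open>Write the left factor as a Q and the right one as P a.\<close>
    have "a\<^sup>2 = a * (Q * P) * a"
      using mp(1) unfolding P_def Q_def power2_eq_square by (metis mult.assoc)
    then show "a\<^sup>2 = 0"
      using QP by simp
    show "bi_EP a"
      using assms QP by (simp add: bi_EP_def P_def Q_def)
  qed

  \<comment> \<open>Now 1 - P and Q generate the same right ideal and both are hermitian
    idempotents, so they coincide; for k the left ideals are compared.\<close>
  have h_P: ?iii if "co_EP a" "co_EP_h a = P"
    using hD(3)[OF that(1)] PQ by (auto simp: that(2) ideal_eq)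
  have k_P: ?iii if "co_EP a" "co_EP_k a = P"
    using kD(3)[OF that(1)] PQ by (auto simp: that(2) ideal_eq)
  have h_herm: "co_EP_h a = P" if "co_EP a" "hermitian (co_EP_h a)"
    using hD[OF that(1)] that PQ by (simp add: ideal_eq)
  have k_herm: "co_EP_k a = P" if "co_EP a" "hermitian (co_EP_k a)"
    using kD[OF that(1)] that PQ by (simp add: ideal_eq)
  \<comment> \<open>The common value h generates the same right ideal as P, so h P = P, and the same
    left ideal, so h P = h.\<close>
  have k_h: "co_EP_h a = P" if "co_EP a" "co_EP_k a = co_EP_h a"
    using hD(1,2)[OF that(1)] kD(2)[OF that(1), unfolded that(2)] iP
    by (metis left_ideal_subset_idempotent_iff right_ideal_subset_idempotent_iff subset_refl)
  have sq_iii: ?iii if co: "co_EP a" and sq: "a\<^sup>2 = 0"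
  proof -
    have "Q * P = a\<^sup>\<dagger> * a\<^sup>2 * a\<^sup>\<dagger>"
      by (simp add: P_def Q_def power2_eq_square mult.assoc)
    then have QP: "Q * P = 0"
      using sq by simp
    have "P * (1 - Q) = 1 - Q"
      by (rule idempotents_mult_eq_0_complement) (use iP iQ QP co coEP_iff in simp_all)
    moreover have "(1 - Q) * P = P"
      using QP by (simp add: algebra_simps)
    ultimately have "P = 1 - Q"
      using PQ by (intro hermitian_idempotent_eqI) simp_all
    then show ?thesis
      by simp
  qed
  have bi_iii: ?iii if "co_EP a" "bi_EP a"
    by (rule commuting_idempotents_sum_eq_1)
      (use that iP iQ coEP_iff in \<open>simp_all add: bi_EP_def P_def Q_def\<close>)

  have "co_EP a \<and> hermitian (co_EP_h a) \<longleftrightarrow> ?iii"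
    and "co_EP a \<and> co_EP_h a = P \<longleftrightarrow> ?iii"
    and "co_EP a \<and> co_EP_k a = P \<longleftrightarrow> ?iii"
    and "co_EP a \<and> hermitian (co_EP_k a) \<longleftrightarrow> ?iii"
    and "co_EP a \<and> co_EP_k a = co_EP_h a \<longleftrightarrow> ?iii"
    and "co_EP a \<and> a\<^sup>2 = 0 \<longleftrightarrow> ?iii"
    and "co_EP a \<and> bi_EP a \<longleftrightarrow> ?iii"
    using coEP h_eq k_eq sq biEP hP h_P k_P h_herm k_herm k_h sq_iii bi_iii by metis+
  with iv v x xi show ?thesis
    unfolding all_equivalent_def P_def[symmetric] Q_def[symmetric] by simp
qed

end
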